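(* Let $t_1,t_2,t_3\in\mathbb{R}$ be such that $$\rho=\frac14\Big[\mathbb{I}_2\otimes\mathbb{I}_2+\sum_{i=1}^{3}t_i\,(\sigma_i\otimes\sigma_i)\Big]$$ is a density operator on $\mathbb{C}^2\otimes\mathbb{C}^2$ (a two-qubit Weyl state), and let $T=\mathrm{diag}(t_1,t_2,t_3)$. If $\rho$ satisfies the sufficient criterion for unsteerability $$\max_{\hat x}\;2\|T\hat x\|\le 1,$$ where the maximum is over unit vectors $\hat x\in\mathbb{R}^3$, then its conditional Rényi 2-entropy is non-negative: $S_2(A|B)_\rho\ge0$.
   Context: $\sigma_1,\sigma_2,\sigma_3$ are the Pauli matrices and $\|\cdot\|$ is the Euclidean norm. The first tensor factor is system $A$ and the second is system $B$. The criterion is the specialization to zero local Bloch vector of a known sufficient condition (Bowles, Hirsch, Quintino, Brunner, 2016): a two-qubit state $\frac14[\mathbb{I}_2\otimes\mathbb{I}_2+\vec{\mathfrak a}\cdot\vec\sigma\otimes\mathbb{I}_2+\sum_i T_i\sigma_i\otimes\sigma_i]$ is unsteerable (admits a local hidden state model) if $\max_{\hat x}[(\vec{\mathfrak a}\cdot\hat x)^2+2\|T\hat x\|]\le1$. Rényi 2-entropy: $S_2(\rho)=-\log\mathrm{Tr}(\rho^2)$ (logarithm to base 2). Conditional Rényi 2-entropy: $S_2(A|B)_\rho=S_2(\rho)-S_2(\rho_B)$, where $\rho_B=\mathrm{Tr}_A\rho$. *)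

theory Defs
  imports "HOL-Analysis.Analysis"
begin

text \<open>
  An operator on a finite-dimensional Hilbert space with orthonormal basis indexed by \<open>'n\<close>
  is its matrix \<open>complex^'n^'n\<close>; the tensor product space carries the product basis, indexed by
  pairs whose first component belongs to system \<open>A\<close> and whose second belongs to system \<open>B\<close>.
\<close>

definition tensor_op ::
    "complex^'a^'a \<Rightarrow> complex^'b^'b \<Rightarrow> complex^('a \<times> 'b)^('a \<times> 'b)"  (infixr "\<otimes>" 75)
  where "M \<otimes> N = (\<chi> p q. M $ fst p $ fst q * N $ snd p $ snd q)"

definition partial_trace_A ::
    "complex^('a::finite \<times> 'b)^('a \<times> 'b) \<Rightarrow> complex^'b^'b"
  where "partial_trace_A M = (\<chi> k l. \<Sum>i\<in>UNIV. M $ (i, k) $ (i, l))"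

definition hermitian :: "complex^'n^'n \<Rightarrow> bool"
  where "hermitian M \<longleftrightarrow> (\<chi> i j. cnj (M $ j $ i)) = M"

text \<open>For Hermitian \<open>M\<close> the quadratic form is real, so \<open>Re\<close> only adjusts the type.\<close>

definition positive_semidefinite :: "complex^'n^'n \<Rightarrow> bool"
  where "positive_semidefinite M \<longleftrightarrow>
    hermitian M \<and> (\<forall>v. 0 \<le> Re (\<Sum>i\<in>UNIV. cnj (v $ i) * (M *v v) $ i))"

definition density_operator :: "complex^'n^'n \<Rightarrow> bool"
  where "density_operator M \<longleftrightarrow> positive_semidefinite M \<and> trace M = 1"

definition pauli :: "3 \<Rightarrow> complex^2^2"  ("\<sigma>")
  where "\<sigma> i =
    (if i = 1 then vector [vector [0, 1], vector [1, 0]]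
     else if i = 2 then vector [vector [0, - \<i>], vector [\<i>, 0]]
     else vector [vector [1, 0], vector [0, - 1]])"

definition diag :: "real^'n \<Rightarrow> real^'n^'n"
  where "diag t = (\<chi> i j. if i = j then t $ i else 0)"

text \<open>The trace of the square of a Hermitian matrix is real, so \<open>Re\<close> only adjusts the type.\<close>

definition renyi2_entropy :: "complex^'n^'n \<Rightarrow> real"
  where "renyi2_entropy M = - log 2 (Re (trace (M ** M)))"

definition cond_renyi2_entropy :: "complex^('a::finite \<times> 'b::finite)^('a \<times> 'b) \<Rightarrow> real"
  where "cond_renyi2_entropy M = renyi2_entropy M - renyi2_entropy (partial_trace_A M)"

end

theory Submission
  imports Defs
begin

text \<open>
  The purity of the Weyl state is \<open>(1 + t\<^sub>1\<^sup>2 + t\<^sub>2\<^sup>2 + t\<^sub>3\<^sup>2) / 4\<close> and its reduced state is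
  maximally mixed, so the conditional entropy is non-negative iff \<open>t\<^sub>1\<^sup>2 + t\<^sub>2\<^sup>2 + t\<^sub>3\<^sup>2 \<le> 1\<close>.
  Evaluating the criterion at the coordinate axes gives \<open>\<bar>t\<^sub>i\<bar> \<le> 1/2\<close>, so that the sum of squares is
  at most \<open>3/4\<close>.
\<close>

definition weyl_operator :: "real^3 \<Rightarrow> complex^(2 \<times> 2)^(2 \<times> 2)"
  where "weyl_operator t =
    (1/4) *\<^sub>R (mat 1 \<otimes> mat 1 + (\<Sum>i\<in>UNIV. (t $ i) *\<^sub>R (\<sigma> i \<otimes> \<sigma> i)))"

lemma sum_UNIV_2_times_2:
  fixes f :: "2 \<times> 2 \<Rightarrow> 'a::comm_monoid_add"
  shows "sum f UNIV = f (1, 1) + f (1, 2) + f (2, 1) + f (2, 2)"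
proof -
  have "sum f UNIV = (\<Sum>i\<in>UNIV. \<Sum>j\<in>UNIV. f (i, j))"
    by (simp add: sum.cartesian_product)
  then show ?thesis
    by (simp add: sum_2 add.assoc)
qed

text \<open>The Kronecker deltas of the two factors of \<open>mat 1 \<otimes> mat 1\<close> merge
  into a single one on index pairs.\<close>

lemma weyl_operator_nth:
  "weyl_operator t $ p $ q = (1/4) *\<^sub>R
    ((if p = q then 1 else 0) + (\<Sum>i\<in>UNIV. (t $ i) *\<^sub>R
      (\<sigma> i $ fst p $ fst q * \<sigma> i $ snd p $ snd q)))"
  by (auto simp: weyl_operator_def tensor_op_def mat_def prod_eq_iff)

lemma pauli_nth:
  "\<sigma> 1 $ 1 $ 1 = 0" "\<sigma> 1 $ 1 $ 2 = 1" "\<sigma> 1 $ 2 $ 1 = 1" "\<sigma> 1 $ 2 $ 2 = 0"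
  "\<sigma> 2 $ 1 $ 1 = 0" "\<sigma> 2 $ 1 $ 2 = - \<i>" "\<sigma> 2 $ 2 $ 1 = \<i>" "\<sigma> 2 $ 2 $ 2 = 0"
  "\<sigma> 3 $ 1 $ 1 = 1" "\<sigma> 3 $ 1 $ 2 = 0" "\<sigma> 3 $ 2 $ 1 = 0" "\<sigma> 3 $ 2 $ 2 = - 1"
  by (simp_all add: pauli_def)

text \<open>The identity and the three \<open>\<sigma> i \<otimes> \<sigma> i\<close> are orthogonal
  for the trace inner product and each squares to the identity, of trace 4. Cross terms therefore
  vanish; expanding all entries verifies this.\<close>

lemma trace_weyl_operator_squared:
  "trace (weyl_operator t ** weyl_operator t) = of_real ((1 + (\<Sum>i\<in>UNIV. (t $ i)\<^sup>2)) / 4)"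
  by (simp add: trace_def matrix_matrix_mult_def sum_UNIV_2_times_2 weyl_operator_nth sum_3
      pauli_nth complex_eq_iff power2_eq_square field_simps)

text \<open>Pauli matrices are traceless, so tracing out A kills every correlation term, while the
  identity term picks up a factor 2.\<close>

lemma partial_trace_A_weyl_operator:
  "partial_trace_A (weyl_operator t) = (1/2) *\<^sub>R mat 1"
  by (simp add: partial_trace_A_def vec_eq_iff forall_2 sum_2 weyl_operator_nth sum_3
      pauli_nth mat_def complex_eq_iff add_divide_distrib diff_divide_distrib)

lemma renyi2_entropy_maximally_mixed_qubit:
  "renyi2_entropy ((1/2) *\<^sub>R mat 1 :: complex^2^2) = 1"
proof -
  have "trace (((1/2) *\<^sub>R mat 1 :: complex^2^2) ** ((1/2) *\<^sub>R mat 1)) = 1/2"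
    by (simp add: trace_def matrix_matrix_mult_def sum_2 mat_def complex_eq_iff)
  then show ?thesis
    by (simp only: renyi2_entropy_def) (simp add: log_divide)
qed

lemma cond_renyi2_entropy_weyl_operator:
  "cond_renyi2_entropy (weyl_operator t) = 1 - log 2 (1 + (\<Sum>i\<in>UNIV. (t $ i)\<^sup>2))"
proof -
  \<comment> \<open>Positivity permits splitting the logarithm of the purity; its denominator 4
    yields the summand 2.\<close>
  have "0 < 1 + (\<Sum>i\<in>UNIV. (t $ i)\<^sup>2)"
    by (simp add: add_pos_nonneg sum_nonneg)
  moreover have "log 2 (4 :: real) = 2"
    using log_pow_cancel[of "2::real" 2] by simp
  ultimately have "renyi2_entropy (weyl_operator t) = 2 - log 2 (1 + (\<Sum>i\<in>UNIV. (t $ i)\<^sup>2))"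
    by (simp only: renyi2_entropy_def trace_weyl_operator_squared Re_complex_of_real)
      (simp add: log_divide)
  then show ?thesis
    by (simp only: cond_renyi2_entropy_def partial_trace_A_weyl_operator
        renyi2_entropy_maximally_mixed_qubit)
qed

lemma abs_nth_le_of_SUP_norm_diag:
  fixes t :: "real^'n"
  assumes "(SUP x\<in>{x :: real^'n. norm x = 1}. 2 * norm (diag t *v x)) \<le> 1"
  shows "\<bar>t $ i\<bar> \<le> 1/2"
proof -
  \<comment> \<open>A real \<open>SUP\<close> dominates its members only when the set is bounded
    above; the operator norm supplies a bound.\<close>
  have "bdd_above ((\<lambda>x. 2 * norm (diag t *v x)) ` {x. norm x = 1})"
  proof (rule bdd_aboveI2)
    fix x :: "real^'n"
    assume "x \<in> {x. norm x = 1}"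
    then show "2 * norm (diag t *v x) \<le> 2 * onorm ((*v) (diag t))"
      using onorm[OF matrix_vector_mul_bounded_linear, of "diag t" x] by simp
  qed
  then have "2 * norm (diag t *v axis i 1) \<le> (SUP x\<in>{x. norm x = 1}. 2 * norm (diag t *v x))"
    by (intro cSUP_upper) simp_all
  \<comment> \<open>Coordinate axes are eigenvectors of a diagonal matrix, so this unit vector
    isolates one coefficient.\<close>
  moreover have "diag t *v axis i 1 = axis i (t $ i)"
    by (simp only: matrix_vector_mult_basis) (simp add: column_def diag_def axis_def vec_eq_iff)
  then have "norm (diag t *v axis i 1) = \<bar>t $ i\<bar>"
    by (simp add: norm_eq_sqrt_inner inner_axis_axis)
  ultimately show ?thesis
    using assms by linarith
qed

theorem mainTheorem5:
  fixes t :: "real^3"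
    and \<rho> :: "complex^(2 \<times> 2)^(2 \<times> 2)"
    and T :: "real^3^3"
  assumes "\<rho> = (1/4) *\<^sub>R (mat 1 \<otimes> mat 1 + (\<Sum>i\<in>UNIV. (t $ i) *\<^sub>R (\<sigma> i \<otimes> \<sigma> i)))"
    and "density_operator \<rho>"
    and "T = diag t"
    and "(SUP x\<in>{x :: real^3. norm x = 1}. 2 * norm (T *v x)) \<le> 1"
  shows "cond_renyi2_entropy \<rho> \<ge> 0"
proof -
  have "\<bar>t $ i\<bar> \<le> 1/2" for i
    using assms(3,4) by (simp only: abs_nth_le_of_SUP_norm_diag)
  then have "(t $ i)\<^sup>2 \<le> (1/2)\<^sup>2" for i
    by (simp only: abs_le_square_iff[symmetric]) simp
  then have "(\<Sum>i\<in>UNIV. (t $ i)\<^sup>2) \<le> (\<Sum>i\<in>(UNIV :: 3 set). (1/2)\<^sup>2)"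
    by (intro sum_mono)
  then have "1 + (\<Sum>i\<in>UNIV. (t $ i)\<^sup>2) \<le> 2"
    by (simp add: power2_eq_square)
  \<comment> \<open>For a positive argument, \<open>log 2\<close> is at most 1 exactly when the
    argument is at most the base.\<close>
  moreover have "0 < 1 + (\<Sum>i\<in>UNIV. (t $ i)\<^sup>2)"
    by (simp add: add_pos_nonneg sum_nonneg)
  ultimately have "log 2 (1 + (\<Sum>i\<in>UNIV. (t $ i)\<^sup>2)) \<le> 1"
    by (simp add: log_le_one_cancel_iff)
  moreover have "\<rho> = weyl_operator t"
    using assms(1) by (simp only: weyl_operator_def)
  ultimately show ?thesis
    by (simp add: cond_renyi2_entropy_weyl_operator)
qed

end
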